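(* Let $\Sigma=\{a,b\}$ and let $h:\Sigma^*\to\Sigma^*$ be the morphism given by $h(a)=abaaaba$ and $h(b)=babab$. Then the fixed point $h^\omega(a)$ contains abelian $8$-powers.
   Context: $\Sigma^*$ is the free monoid of finite words over $\Sigma$; a morphism is a monoid homomorphism. Since $h(a)$ begins with $a$ and has length greater than $1$, each $h^n(a)$ is a proper prefix of $h^{n+1}(a)$, and $h^\omega(a)$ denotes the infinite word having every $h^n(a)$ as a prefix (a fixed point of $h$). A word contains an abelian $k$-power if it has a factor (contiguous finite subword) of the form $v_1v_2\cdots v_k$ where $v_1,\dots,v_k$ are non-empty words that are permutations (anagrams) of one another. *)

theory Defs
  imports "HOL-Library.Multiset" "HOL-Library.Omega_Words_Fun"
begin

text \<open>
  Finite words are lists. Infinite words are functions on the naturals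
  (type \<^typ>\<open>'a word\<close> of the library theory on omega-words), for which
  \<^term>\<open>w [i \<rightarrow> j]\<close> is the factor of length \<^term>\<open>j - i\<close> starting at position
  \<^term>\<open>i\<close>, and \<^term>\<open>prefix n w\<close> the prefix of length \<^term>\<open>n\<close>.
\<close>

datatype letter = A | B

primrec h_letter :: "letter \<Rightarrow> letter list" where
  "h_letter A = [A, B, A, A, A, B, A]"
| "h_letter B = [B, A, B, A, B]"

definition h :: "letter list \<Rightarrow> letter list" where
  "h w = concat (map h_letter w)"

lemma h_morphism: "h [] = []" "h (u @ v) = h u @ h v"
  by (simp_all add: h_def)

lemma h_letters: "h [A] = [A, B, A, A, A, B, A]" "h [B] = [B, A, B, A, B]"
  by (simp_all add: h_def)

lemma h_unique:
  assumes "f [] = []" and "\<And>u v. f (u @ v) = f u @ f v"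
    and "f [A] = [A, B, A, A, A, B, A]" and "f [B] = [B, A, B, A, B]"
  shows "f = h"
proof
  fix w
  show "f w = h w"
  proof (induction w)
    case Nil
    then show ?case by (simp add: assms(1) h_morphism)
  next
    case (Cons x w)
    have "f [x] = h [x]"
      by (cases x) (simp_all only: assms(3,4) h_letters)
    then show ?case
      using assms(2)[of "[x]" w] h_morphism(2)[of "[x]" w] Cons by simp
  qed
qed

definition is_iteration_limit :: "('a list \<Rightarrow> 'a list) \<Rightarrow> 'a \<Rightarrow> 'a word \<Rightarrow> bool" where
  "is_iteration_limit f x w \<longleftrightarrow>
     (\<forall>n. prefix (length ((f ^^ n) [x])) w = (f ^^ n) [x])"

text \<open>
  The infinite word \<open>f\<^sup>\<omega>(x)\<close>. It is meaningful only if exactly one word satisfies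
  \<^const>\<open>is_iteration_limit\<close>; lemma \<open>h_omega_ex1\<close> below shows this for \<^term>\<open>h\<close> and
  \<^term>\<open>A\<close>.
\<close>

definition iteration_limit :: "('a list \<Rightarrow> 'a list) \<Rightarrow> 'a \<Rightarrow> 'a word" where
  "iteration_limit f x = (THE w. is_iteration_limit f x w)"

definition abelian_power :: "nat \<Rightarrow> 'a list \<Rightarrow> bool" where
  "abelian_power k v \<longleftrightarrow>
     (\<exists>vs. length vs = k \<and> v = concat vs \<and> [] \<notin> set vs \<and>
       (\<forall>x\<in>set vs. \<forall>y\<in>set vs. mset x = mset y))"

definition contains_abelian_power :: "nat \<Rightarrow> 'a word \<Rightarrow> bool" where
  "contains_abelian_power k w \<longleftrightarrow> (\<exists>i j. i \<le> j \<and> abelian_power k (w [i \<rightarrow> j]))"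

lemma h_length_ge: "length (h w) \<ge> length w"
proof (induction w)
  case Nil
  then show ?case by simp
next
  case (Cons x w)
  have "length (h_letter x) \<ge> 1" by (cases x) simp_all
  then show ?case using Cons by (simp add: h_def)
qed

lemma h_pow_Suc_prefix: "\<exists>v. v \<noteq> [] \<and> (h ^^ Suc n) [A] = (h ^^ n) [A] @ v"
proof (induction n)
  case 0
  show ?case by (simp add: h_letters)
next
  case (Suc n)
  then obtain v where v: "v \<noteq> []" "(h ^^ Suc n) [A] = (h ^^ n) [A] @ v" by blast
  have "(h ^^ Suc (Suc n)) [A] = h ((h ^^ Suc n) [A])" by simp
  also have "\<dots> = h ((h ^^ n) [A]) @ h v" by (simp only: v(2) h_morphism)
  finally have "(h ^^ Suc (Suc n)) [A] = (h ^^ Suc n) [A] @ h v" by simp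
  moreover have "h v \<noteq> []" using h_length_ge[of v] v(1) by auto
  ultimately show ?case by blast
qed

lemma h_pow_length: "length ((h ^^ n) [A]) > n"
proof (induction n)
  case 0
  show ?case by simp
next
  case (Suc n)
  obtain v where "v \<noteq> []" "(h ^^ Suc n) [A] = (h ^^ n) [A] @ v"
    using h_pow_Suc_prefix by blast
  then show ?case using Suc by (cases v) auto
qed

lemma h_pow_nth:
  assumes "m \<le> n" and "i < length ((h ^^ m) [A])"
  shows "(h ^^ n) [A] ! i = (h ^^ m) [A] ! i \<and> i < length ((h ^^ n) [A])"
  using assms(1)
proof (induction n rule: dec_induct)
  case base
  show ?case using assms(2) by simp
next
  case (step n)
  obtain v where "(h ^^ Suc n) [A] = (h ^^ n) [A] @ v"
    using h_pow_Suc_prefix by blast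
  then show ?case using step by (simp add: nth_append)
qed

lemma h_omega_ex1: "\<exists>!w. is_iteration_limit h A w"
proof (rule ex1I)
  let ?w = "\<lambda>i. (h ^^ i) [A] ! i"
  have "?w i = (h ^^ n) [A] ! i" if "i < length ((h ^^ n) [A])" for n i
    using h_pow_nth[of n i i] h_pow_nth[of i n i] h_pow_length[of i] that
    by (cases "n \<le> i") auto
  then show "is_iteration_limit h A ?w"
    by (auto simp: is_iteration_limit_def intro!: nth_equalityI)
next
  fix w assume w: "is_iteration_limit h A w"
  show "w = (\<lambda>i. (h ^^ i) [A] ! i)"
  proof
    fix i
    have "prefix (length ((h ^^ i) [A])) w = (h ^^ i) [A]"
      using w by (simp add: is_iteration_limit_def)
    then have "prefix (length ((h ^^ i) [A])) w ! i = (h ^^ i) [A] ! i" by simp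
    then show "w i = (h ^^ i) [A] ! i" using h_pow_length[of i] by simp
  qed
qed

lemma h_omega_limit: "is_iteration_limit h A (iteration_limit h A)"
  unfolding iteration_limit_def by (rule theI'[OF h_omega_ex1])

end

theory Submission
  imports Defs
begin

text \<open>
  If the fixed point has a prefix \<open>u x\<close> with \<open>x\<close> a letter, then \<open>h(u)\<close> followed by the first
  \<open>k\<close> letters of \<open>h(x)\<close> is again a prefix, and its Parikh vector is the image of that of \<open>u\<close>
  under the incidence matrix of \<open>h\<close>, plus a term depending only on \<open>x\<close> and \<open>k\<close>. So a prefix
  is addressed by its digits \<open>k\<close>, and its Parikh vector is computed by a Horner scheme.
  A computer search gives nine prefixes of length \<open>23864 + 2286 j\<close>, \<open>j \<le> 8\<close>, whose Parikh
  vectors are in arithmetic progression; consecutive ones cut out the abelian \<open>8\<close>-power.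
\<close>

lemma subsequence_append_adjacent:
  assumes "i \<le> j" and "j \<le> k"
  shows "w [i \<rightarrow> j] @ w [j \<rightarrow> k] = w [i \<rightarrow> k]"
  using upt_add_eq_append[of i j "k - j"] assms
  by (simp add: subsequence_def flip: map_append)

text \<open>Successive prefixes differ by one block, so a constant difference \<open>N\<close> of
  their multisets makes all blocks anagrams; \<open>q > 0\<close> keeps the blocks
  non-empty.\<close>

lemma contains_abelian_power_if_progression:
  fixes w :: "'a word"
  assumes "q > 0"
    and progression: "\<And>j. j \<le> k \<Longrightarrow> mset (prefix (m + j * q) w) = M + repeat_mset j N"
  shows "contains_abelian_power k w"
proof -
  define v where "v j = w [m + j * q \<rightarrow> m + Suc j * q]" for j
  define vs where "vs = map v [0..<k]"
  have concat: "concat (map v [0..<j]) = w [m \<rightarrow> m + j * q]" for j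
  proof (induction j)
    case 0
    show ?case by simp
  next
    case (Suc j)
    have "w [m \<rightarrow> m + j * q] @ v j = w [m \<rightarrow> m + Suc j * q]"
      unfolding v_def by (rule subsequence_append_adjacent) simp_all
    then show ?case
      using Suc by simp
  qed
  have block: "mset (v j) = N" if "j < k" for j
  proof -
    have "prefix (m + j * q) w @ v j = prefix (m + Suc j * q) w"
      unfolding v_def by (rule subsequence_append_adjacent) simp_all
    then have "mset (prefix (m + j * q) w) + mset (v j) = mset (prefix (m + Suc j * q) w)"
      by (metis mset_append)
    then show ?thesis
      using progression[of j] progression[of "Suc j"] that by simp
  qed
  have "length (v j) \<noteq> 0" for j
    using \<open>q > 0\<close> by (simp add: v_def)
  then have "[] \<notin> set vs"
    unfolding vs_def by (metis ex_map_conv list.size(3))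
  then have "abelian_power k (concat vs)"
    unfolding abelian_power_def
    by (intro exI[of _ vs]) (auto simp: vs_def block)
  then show ?thesis
    unfolding contains_abelian_power_def vs_def concat
    by (intro exI[of _ m] exI[of _ "m + k * q"]) simp
qed

lemma length_letters: "length u = count_list u A + count_list u B"
proof (induction u)
  case (Cons x u)
  then show ?case by (cases x) simp_all
qed simp

lemma mset_letters:
  "mset u = replicate_mset (count_list u A) A + replicate_mset (count_list u B) B"
proof (induction u)
  case (Cons x u)
  then show ?case by (cases x) simp_all
qed simp

lemma count_list_h:
  "count_list (h u) A = 5 * count_list u A + 2 * count_list u B"
  "count_list (h u) B = 2 * count_list u A + 3 * count_list u B"
proof (induction u)
  case (Cons x u)
  { case 1 show ?case using Cons by (cases x) (simp_all add: h_def) }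
  { case 2 show ?case using Cons by (cases x) (simp_all add: h_def) }
qed (simp_all add: h_def)

text \<open>Serves to pass from a known prefix to a shorter one.\<close>

lemma prefix_append_iff:
  "prefix (length (u @ v)) w = u @ v \<longleftrightarrow>
     prefix (length u) w = u \<and> w [length u \<rightarrow> length u + length v] = v"
  by (simp add: subsequence_append)

text \<open>The iterate with exponent \<open>length u\<close> is longer than \<open>u\<close>, hence
  extends it; then \<open>h u\<close> begins the next iterate, which is itself a prefix of the
  limit.\<close>

lemma h_prefix:
  assumes "prefix (length u) (iteration_limit h A) = u"
  shows "prefix (length (h u)) (iteration_limit h A) = h u"
proof -
  let ?w = "iteration_limit h A"
  have limit: "prefix (length ((h ^^ n) [A])) ?w = (h ^^ n) [A]" for n
    using h_omega_limit by (simp add: is_iteration_limit_def)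
  let ?p = "(h ^^ length u) [A]"
  have "length u \<le> length ?p"
    using h_pow_length[of "length u"] by simp
  then have "take (length u) (prefix (length ?p) ?w) = u"
    using assms by (simp add: subsequence_def take_map)
  then obtain v where "?p = u @ v"
    unfolding limit by (metis append_take_drop_id)
  then have "(h ^^ Suc (length u)) [A] = h u @ h v"
    by (simp add: h_morphism)
  then show ?thesis
    using limit[of "Suc (length u)"] by (simp only: prefix_append_iff)
qed

text \<open>The letter \<open>x\<close> after the prefix is recorded because it is the image of
  \<open>x\<close> that the next digit cuts.\<close>

definition cut :: "letter \<Rightarrow> nat \<Rightarrow> nat \<Rightarrow> bool" where
  "cut x a b \<longleftrightarrow> (\<exists>u. prefix (length (u @ [x])) (iteration_limit h A) = u @ [x] \<and>
     count_list u A = a \<and> count_list u B = b)"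

lemma cut_start: "cut A 0 0"
proof -
  have "prefix (length ((h ^^ 0) [A])) (iteration_limit h A) = (h ^^ 0) [A]"
    using h_omega_limit unfolding is_iteration_limit_def by blast
  then show ?thesis
    unfolding cut_def by (intro exI[of _ "[]"]) simp
qed

lemma cut_step:
  assumes "cut x a b" and k: "k < length (h_letter x)"
  shows "cut (h_letter x ! k)
    (5 * a + 2 * b + count_list (take k (h_letter x)) A)
    (2 * a + 3 * b + count_list (take k (h_letter x)) B)"
proof -
  obtain u where u: "prefix (length (u @ [x])) (iteration_limit h A) = u @ [x]"
      "count_list u A = a" "count_list u B = b"
    using assms(1) unfolding cut_def by blast
  let ?u = "h u @ take k (h_letter x)"
  have "h (u @ [x]) = (?u @ [h_letter x ! k]) @ drop (Suc k) (h_letter x)"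
    using id_take_nth_drop[OF k] by (simp add: h_def)
  then have "prefix (length (?u @ [h_letter x ! k])) (iteration_limit h A)
      = ?u @ [h_letter x ! k]"
    using h_prefix[OF u(1)] by (simp only: prefix_append_iff)
  then show ?thesis
    unfolding cut_def using u(2,3) by (intro exI[of _ ?u]) (simp add: count_list_h)
qed

text \<open>Digits are read from the most significant one. Only the next letter and two counts are
  carried along, so evaluation never writes out a long prefix.\<close>

primrec leads :: "nat list \<Rightarrow> letter \<Rightarrow> nat \<Rightarrow> nat \<Rightarrow> nat \<times> nat \<Rightarrow> bool" where
  "leads [] x a b c \<longleftrightarrow> c = (a, b)"
| "leads (k # ks) x a b c \<longleftrightarrow> k < length (h_letter x) \<and>
     leads ks (h_letter x ! k)
       (5 * a + 2 * b + count_list (take k (h_letter x)) A)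
       (2 * a + 3 * b + count_list (take k (h_letter x)) B) c"

lemma mset_prefix_if_leads:
  assumes "cut x a b" and "leads ks x a b (c, d)"
  shows "mset (prefix (c + d) (iteration_limit h A)) = replicate_mset c A + replicate_mset d B"
  using assms
proof (induction ks arbitrary: x a b)
  case Nil
  then obtain u where u: "prefix (length (u @ [x])) (iteration_limit h A) = u @ [x]"
      "count_list u A = c" "count_list u B = d"
    unfolding cut_def by auto
  then show ?case
    \<comment> \<open>The letter \<open>x\<close> is dropped, and \<open>length u\<close> is
      \<open>c + d\<close> because there are only two letters.\<close>
    using mset_letters[of u] length_letters[of u] by (simp only: prefix_append_iff)
next
  case (Cons k ks)
  then show ?case using cut_step[of x a b k] by auto
qed

theorem proposition3p6:
  shows "contains_abelian_power 8 (iteration_limit h A)"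
proof (rule contains_abelian_power_if_progression)
  fix j :: nat
  assume "j \<le> 8"
  define digits :: "nat list list" where
    \<comment> \<open>Found by search: row \<open>j\<close> addresses the \<open>j\<close>-th prefix
      inside the sixth iterate of \<open>h\<close> on \<open>A\<close>.\<close>
    "digits = [[2, 3, 5, 1, 3, 4],
      [2, 5, 0, 3, 0, 6],
      [2, 6, 4, 6, 5, 1],
      [3, 1, 0, 1, 2, 5],
      [3, 2, 4, 5, 0, 0],
      [3, 3, 6, 6, 4, 2],
      [3, 5, 2, 1, 1, 4],
      [3, 6, 6, 4, 6, 1],
      [4, 1, 1, 6, 3, 3]]"
  \<comment> \<open>With \<open>j\<close> a numeral, each address is checked by plain evaluation.
    Each block has 1414 letters \<open>A\<close> and 872 letters \<open>B\<close>.\<close>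
  have "j \<in> {0, 1, 2, 3, 4, 5, 6, 7, 8}"
    using \<open>j \<le> 8\<close> by auto
  then have "leads (digits ! j) A 0 0 (14750 + j * 1414, 9114 + j * 872)"
    by (elim insertE emptyE) (simp_all add: digits_def)
  then have "mset (prefix (14750 + j * 1414 + (9114 + j * 872)) (iteration_limit h A))
      = replicate_mset (14750 + j * 1414) A + replicate_mset (9114 + j * 872) B"
    using mset_prefix_if_leads[OF cut_start] by blast
  moreover have "14750 + j * 1414 + (9114 + j * 872) = 23864 + j * 2286"
    by simp
  ultimately show "mset (prefix (23864 + j * 2286) (iteration_limit h A)) =
      (replicate_mset 14750 A + replicate_mset 9114 B) +
      repeat_mset j (replicate_mset 1414 A + replicate_mset 872 B)"
    by (intro multiset_eqI) (simp only:, simp)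
qed simp

end
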